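(* Let $Y$ and $Z$ be real Banach spaces, $\Omega$ a nonempty open subset of $Z$, $k\in\mathbb N$, and let $M$ be a nonempty bounded subset of the locally convex space $\mathcal D^k(\Omega,Y)$. Then $$\max\left\{\mu_{\alpha_\tau}(M),\ \tfrac12\,\omega_{\mathcal D^k}(M)\right\}\le\alpha_{\mathcal D^k}(M)\le\mu_{\alpha_\tau}(M)+2\,\omega_{\mathcal D^k}(M),$$ where all terms are functions from $\mathcal K$ (the family of all compact subsets of $\Omega$) to $[0,+\infty)$ and the inequalities are understood pointwise on $\mathcal K$.
   Context: Differentiability is in the Fréchet sense. $\mathcal C^k(\Omega,Y)$ is the space of $k$-times continuously differentiable functions $f:\Omega\to Y$; for $p=0,\dots,k$, $d^pf:\Omega\to W_p$ is the differential of order $p$, where $W_p=\mathcal L(Z^p,Y)$ is the Banach space of bounded $p$-linear operators with the operator norm ($W_0=Y$, $d^0f=f$). $\mathcal D^k(\Omega,Y)$ is $\mathcal C^k(\Omega,Y)$ endowed with the topology $\tau$ generated by the seminorms $\|f\|_{\mathcal C^k,K}=\max_{0\le p\le k}\sup_{x\in K}\|d^pf(x)\|$, $K\in\mathcal K$, where $\mathcal K$ is the family of all compact subsets of $\Omega$. A set is bounded in $\mathcal D^k(\Omega,Y)$ if it is bounded for each of these seminorms. For bounded $M\subseteq\mathcal D^k(\Omega,Y)$ and $K\in\mathcal K$: - $\alpha_{\mathcal D^k}(M)(K)$ is the Kuratowski measure of noncompactness of $M$ with respect to the seminorm $\|\cdot\|_{\mathcal C^k,K}$, i.e. the infimum of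 all $\varepsilon>0$ such that $M$ can be covered by finitely many sets whose diameter with respect to $\|\cdot\|_{\mathcal C^k,K}$ is not greater than $\varepsilon$; - $\mu_{\alpha_\tau}(M)(K)=\max_{0\le p\le k}\sup_{x\in K}\alpha_p(M^p(x))$, where $M^p(x)=\{d^pf(x):f\in M\}\subseteq W_p$ and $\alpha_p$ is the Kuratowski measure of noncompactness in $W_p$ (infimum of all $\varepsilon>0$ such that the set can be covered by finitely many sets of diameter not greater than $\varepsilon$); - $\omega_{\mathcal D^k}(M)(K)$ is the maximum over $p=0,\dots,k$ of the infimum of all $\varepsilon>0$ for which there is a finite partition $\{A_1,\dots,A_n\}$ of $K$ such that, for all $f\in M$, $\operatorname{diam}_{W_p}(d^pf(A_i))\le\varepsilon$ for $i=1,\dots,n$. *)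

theory Defs
  imports "HOL-Analysis.Analysis" "HOL-Library.Disjoint_Sets"
begin

section \<open>Bounded multilinear operators\<close>

text \<open>
  The spaces \<open>W\<^sub>p = L(Z\<^sup>p, Y)\<close> for varying \<open>p\<close> are realised inside a single normed space: an element
  of type \<open>mlin\<close> is a family of bounded \<open>p\<close>-linear maps, one for every \<open>p\<close> (the tuple of arguments is
  a list, and its length is \<open>p\<close>), whose operator norms are uniformly bounded; the norm is the
  supremum of these operator norms. \<open>W\<^sub>p\<close> is the subspace \<open>mlin_space p\<close> of the elements that vanish on
  lists of length other than \<open>p\<close>; there the norm is the usual operator norm (lemma
  \<open>norm_mlin_space\<close>). In this way the Frechet derivative, continuity and the metric on \<open>W\<^sub>p\<close> are those
  of the library.
\<close>

typedef (overloaded) ('a, 'b) mlin =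
  "{T :: 'a::real_normed_vector list \<Rightarrow> 'b::real_normed_vector.
      (\<forall>xs ys. linear (\<lambda>v. T (xs @ v # ys))) \<and>
      (\<exists>C. \<forall>vs. norm (T vs) \<le> C * prod_list (map norm vs))}"
  morphisms mlin_apply Mlin
  by (rule exI[of _ "\<lambda>_. 0"]) (auto intro!: linear_zero exI[of _ 0])

lemma mlin_eqI: "(\<And>vs. mlin_apply S vs = mlin_apply T vs) \<Longrightarrow> S = T"
  by (metis ext mlin_apply_inject)

lemma linear_mlin_apply: "linear (\<lambda>v. mlin_apply T (xs @ v # ys))"
  using mlin_apply[of T] by auto

lemma bounded_mlin_apply: "\<exists>C. \<forall>vs. norm (mlin_apply T vs) \<le> C * prod_list (map norm vs)"
  using mlin_apply[of T] by auto

lemma Mlin_inverse':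
  assumes "\<And>xs ys. linear (\<lambda>v. T (xs @ v # ys))"
    and "\<And>vs. norm (T vs) \<le> C * prod_list (map norm vs)"
  shows "mlin_apply (Mlin T) = T"
  by (rule Mlin_inverse) (use assms in auto)

instantiation mlin :: (real_normed_vector, real_normed_vector) real_normed_vector
begin

definition zero_mlin :: "('a, 'b) mlin" where
  "zero_mlin = Mlin (\<lambda>_. 0)"
definition plus_mlin :: "('a, 'b) mlin \<Rightarrow> ('a, 'b) mlin \<Rightarrow> ('a, 'b) mlin" where
  "plus_mlin S T = Mlin (\<lambda>vs. mlin_apply S vs + mlin_apply T vs)"
definition minus_mlin :: "('a, 'b) mlin \<Rightarrow> ('a, 'b) mlin \<Rightarrow> ('a, 'b) mlin" where
  "minus_mlin S T = Mlin (\<lambda>vs. mlin_apply S vs - mlin_apply T vs)"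
definition uminus_mlin :: "('a, 'b) mlin \<Rightarrow> ('a, 'b) mlin" where
  "uminus_mlin T = Mlin (\<lambda>vs. - mlin_apply T vs)"
definition scaleR_mlin :: "real \<Rightarrow> ('a, 'b) mlin \<Rightarrow> ('a, 'b) mlin" where
  "scaleR_mlin c T = Mlin (\<lambda>vs. c *\<^sub>R mlin_apply T vs)"
definition norm_mlin :: "('a, 'b) mlin \<Rightarrow> real" where
  "norm_mlin T = (SUP vs\<in>{vs. \<forall>v\<in>set vs. norm v \<le> 1}. norm (mlin_apply T vs))"
definition dist_mlin :: "('a, 'b) mlin \<Rightarrow> ('a, 'b) mlin \<Rightarrow> real" where
  "dist_mlin S T = norm (S - T)"
definition sgn_mlin :: "('a, 'b) mlin \<Rightarrow> ('a, 'b) mlin" where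
  "sgn_mlin T = inverse (norm T) *\<^sub>R T"
definition uniformity_mlin :: "(('a, 'b) mlin \<times> ('a, 'b) mlin) filter" where [code del]:
  "uniformity_mlin = (INF e\<in>{0<..}. principal {(x, y). dist x y < e})"
definition open_mlin :: "('a, 'b) mlin set \<Rightarrow> bool" where [code del]:
  "open_mlin S = (\<forall>x\<in>S. \<forall>\<^sub>F (x', y) in uniformity. x' = x \<longrightarrow> y \<in> S)"

lemma mlin_apply_zero: "mlin_apply (0 :: ('a, 'b) mlin) = (\<lambda>_. 0)"
  unfolding zero_mlin_def by (rule Mlin_inverse'[where C = 0]) (auto intro: linear_zero)

lemma mlin_apply_add:
  "mlin_apply (S + T :: ('a, 'b) mlin) = (\<lambda>vs. mlin_apply S vs + mlin_apply T vs)"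
proof -
  obtain C D where "\<And>vs. norm (mlin_apply S vs) \<le> C * prod_list (map norm vs)"
    "\<And>vs. norm (mlin_apply T vs) \<le> D * prod_list (map norm vs)"
    using bounded_mlin_apply[of S] bounded_mlin_apply[of T] by blast
  then show ?thesis unfolding plus_mlin_def
    by (intro Mlin_inverse'[where C = "C + D"])
       (auto intro!: linear_compose_add linear_mlin_apply norm_triangle_mono simp: distrib_right)
qed

lemma mlin_apply_scaleR:
  "mlin_apply (c *\<^sub>R T :: ('a, 'b) mlin) = (\<lambda>vs. c *\<^sub>R mlin_apply T vs)"
proof -
  obtain C where "\<And>vs. norm (mlin_apply T vs) \<le> C * prod_list (map norm vs)"
    using bounded_mlin_apply[of T] by blast
  then show ?thesis unfolding scaleR_mlin_def
    by (intro Mlin_inverse'[where C = "\<bar>c\<bar> * C"])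
       (auto intro!: linear_compose_scale_right linear_mlin_apply mult_left_mono simp: mult.assoc)
qed

lemma mlin_apply_uminus: "mlin_apply (- T :: ('a, 'b) mlin) = (\<lambda>vs. - mlin_apply T vs)"
proof -
  have "- T = (-1) *\<^sub>R T" by (simp add: uminus_mlin_def scaleR_mlin_def)
  then show ?thesis by (simp add: mlin_apply_scaleR)
qed

lemma mlin_apply_diff:
  "mlin_apply (S - T :: ('a, 'b) mlin) = (\<lambda>vs. mlin_apply S vs - mlin_apply T vs)"
proof -
  have "S - T = S + - T" by (simp add: minus_mlin_def plus_mlin_def mlin_apply_uminus)
  then show ?thesis by (simp add: mlin_apply_add mlin_apply_uminus)
qed

lemma bdd_above_mlin:
  "bdd_above ((\<lambda>vs. norm (mlin_apply (T :: ('a, 'b) mlin) vs)) ` {vs. \<forall>v\<in>set vs. norm v \<le> 1})"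
proof -
  obtain C where C: "\<And>vs. norm (mlin_apply T vs) \<le> C * prod_list (map norm vs)"
    using bounded_mlin_apply[of T] by blast
  have P: "0 \<le> prod_list (map norm vs) \<and> prod_list (map norm vs) \<le> 1"
    if "\<forall>v\<in>set vs. norm v \<le> 1" for vs :: "'a list"
    using that by (induction vs) (auto intro: mult_le_one)
  have "norm (mlin_apply T vs) \<le> \<bar>C\<bar>" if "\<forall>v\<in>set vs. norm v \<le> 1" for vs
  proof -
    have "norm (mlin_apply T vs) \<le> \<bar>C\<bar> * prod_list (map norm vs)"
      by (rule order.trans[OF C]) (use P[OF that] in \<open>auto intro: mult_right_mono\<close>)
    also have "\<dots> \<le> \<bar>C\<bar>" using P[OF that] by (auto intro: mult_left_le)
    finally show ?thesis .
  qed
  then show ?thesis by (auto simp: bdd_above_def)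
qed

lemma norm_mlin_upper:
  "(\<And>v. v \<in> set vs \<Longrightarrow> norm v \<le> 1) \<Longrightarrow> norm (mlin_apply (T :: ('a, 'b) mlin) vs) \<le> norm T"
  unfolding norm_mlin_def by (rule cSUP_upper[OF _ bdd_above_mlin]) auto

lemma norm_mlin_least:
  "(\<And>vs. (\<And>v. v \<in> set vs \<Longrightarrow> norm v \<le> 1) \<Longrightarrow> norm (mlin_apply (T :: ('a, 'b) mlin) vs) \<le> C)
    \<Longrightarrow> norm T \<le> C"
  unfolding norm_mlin_def by (rule cSUP_least) (auto intro: exI[of _ "[]"])

lemma mlin_apply_scale_list:
  "mlin_apply (T :: ('a, 'b) mlin) (xs @ map (\<lambda>v. c v *\<^sub>R g v) vs)
    = prod_list (map c vs) *\<^sub>R mlin_apply T (xs @ map g vs)"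
proof (induction vs arbitrary: xs)
  case (Cons v vs)
  have "mlin_apply T (xs @ map (\<lambda>v. c v *\<^sub>R g v) (v # vs))
      = c v *\<^sub>R mlin_apply T (xs @ g v # map (\<lambda>v. c v *\<^sub>R g v) vs)"
    using linear_cmul[OF linear_mlin_apply] by simp
  also have "mlin_apply T (xs @ g v # map (\<lambda>v. c v *\<^sub>R g v) vs)
      = prod_list (map c vs) *\<^sub>R mlin_apply T (xs @ g v # map g vs)"
    using Cons.IH[of "xs @ [g v]"] by simp
  finally show ?case by simp
qed simp

lemma norm_mlin_apply:
  "norm (mlin_apply (T :: ('a, 'b) mlin) vs) \<le> norm T * prod_list (map norm vs)"
proof -
  have [simp]: "norm v *\<^sub>R sgn v = v" for v :: 'a
    by (cases "v = 0") (auto simp: sgn_div_norm)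
  have nn: "0 \<le> prod_list (map norm vs)"
    by (induction vs) auto
  have "mlin_apply T vs = prod_list (map norm vs) *\<^sub>R mlin_apply T (map sgn vs)"
    using mlin_apply_scale_list[of T "[]" norm sgn vs] by simp
  then have "norm (mlin_apply T vs) = prod_list (map norm vs) * norm (mlin_apply T (map sgn vs))"
    using nn by simp
  also have "\<dots> \<le> prod_list (map norm vs) * norm T"
    by (intro mult_left_mono nn norm_mlin_upper) (auto simp: norm_sgn)
  finally show ?thesis by (simp add: mult.commute)
qed

instance
proof
  fix S T U :: "('a, 'b) mlin" and a b :: real
  show "S + T + U = S + (T + U)" "S + T = T + S" "0 + S = S" "- S + S = 0" "S - T = S + - T"
    by (auto intro!: mlin_eqI
        simp: mlin_apply_add mlin_apply_zero mlin_apply_uminus mlin_apply_diff algebra_simps)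
  show "a *\<^sub>R (S + T) = a *\<^sub>R S + a *\<^sub>R T" "(a + b) *\<^sub>R S = a *\<^sub>R S + b *\<^sub>R S"
    "a *\<^sub>R b *\<^sub>R S = (a * b) *\<^sub>R S" "1 *\<^sub>R S = S"
    by (auto intro!: mlin_eqI simp: mlin_apply_add mlin_apply_scaleR algebra_simps)
  show "dist S T = norm (S - T)" by (rule dist_mlin_def)
  show "sgn S = inverse (norm S) *\<^sub>R S" by (rule sgn_mlin_def)
  show "uniformity = (INF e\<in>{0<..}. principal {(x, y :: ('a, 'b) mlin). dist x y < e})"
    by (rule uniformity_mlin_def)
  show "open X = (\<forall>x\<in>X. \<forall>\<^sub>F (x', y) in uniformity. x' = x \<longrightarrow> y \<in> X)"
    for X :: "('a, 'b) mlin set" by (rule open_mlin_def)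
  have nn: "0 \<le> norm R" for R :: "('a, 'b) mlin"
    by (rule order.trans[OF norm_ge_zero norm_mlin_upper[of "[]"]]) simp
  show "norm S = 0 \<longleftrightarrow> S = 0"
  proof
    assume "norm S = 0"
    then have "norm (mlin_apply S vs) \<le> 0" for vs
      using norm_mlin_apply[of S vs] by simp
    then show "S = 0" by (auto intro!: mlin_eqI simp: mlin_apply_zero)
  next
    assume "S = 0"
    then have "norm S \<le> 0" by (intro norm_mlin_least) (simp add: mlin_apply_zero)
    then show "norm S = 0" using nn[of S] by simp
  qed
  show "norm (S + T) \<le> norm S + norm T"
    by (rule norm_mlin_least)
       (auto simp: mlin_apply_add intro!: norm_triangle_mono norm_mlin_upper)
  have le: "norm (c *\<^sub>R R) \<le> \<bar>c\<bar> * norm R" for c and R :: "('a, 'b) mlin"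
    by (rule norm_mlin_least)
       (auto simp: mlin_apply_scaleR intro!: mult_left_mono norm_mlin_upper)
  show "norm (a *\<^sub>R S) = \<bar>a\<bar> * norm S"
  proof (cases "a = 0")
    case True
    then show ?thesis using le[of a S] nn[of "a *\<^sub>R S"] by simp
  next
    case False
    have "inverse a *\<^sub>R a *\<^sub>R S = S"
      using False by (auto intro!: mlin_eqI simp: mlin_apply_scaleR)
    then have "norm S \<le> \<bar>inverse a\<bar> * norm (a *\<^sub>R S)"
      using le[of "inverse a" "a *\<^sub>R S"] by simp
    then have "\<bar>a\<bar> * norm S \<le> norm (a *\<^sub>R S)"
      using False by (simp add: field_simps abs_inverse)
    then show ?thesis using le[of a S] by simp
  qed
qed

end

definition mlin_space :: "nat \<Rightarrow> ('a::real_normed_vector, 'b::real_normed_vector) mlin set" where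
  "mlin_space p = {T. \<forall>vs. length vs \<noteq> p \<longrightarrow> mlin_apply T vs = 0}"

lemma norm_mlin_space:
  fixes T :: "('a::real_normed_vector, 'b::real_normed_vector) mlin"
  assumes "T \<in> mlin_space p"
  shows "norm T =
    (SUP vs\<in>{vs. length vs = p \<and> (\<forall>v\<in>set vs. norm v \<le> 1)}. norm (mlin_apply T vs))"
    (is "_ = Sup ?A")
proof (rule antisym)
  have bdd: "bdd_above ?A"
    by (rule bdd_above_mono[OF bdd_above_mlin[of T]]) auto
  have mem: "replicate p 0 \<in> {vs. length vs = p \<and> (\<forall>v\<in>set vs. norm (v::'a) \<le> 1)}"
    by auto
  show "norm T \<le> Sup ?A"
  proof (rule norm_mlin_least)
    fix vs :: "'a list" assume *: "\<And>v. v \<in> set vs \<Longrightarrow> norm v \<le> 1"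
    show "norm (mlin_apply T vs) \<le> Sup ?A"
    proof (cases "length vs = p")
      case True
      then show ?thesis using * by (intro cSUP_upper[OF _ bdd]) auto
    next
      case False
      then have "norm (mlin_apply T vs) \<le> norm (mlin_apply T (replicate p 0))"
        using assms by (simp add: mlin_space_def)
      also have "\<dots> \<le> Sup ?A" by (rule cSUP_upper[OF mem bdd])
      finally show ?thesis .
    qed
  qed
  show "Sup ?A \<le> norm T"
    using mem by (intro cSUP_least) (blast, auto intro: norm_mlin_upper)
qed


section \<open>Higher differentials and continuously differentiable functions\<close>

text \<open>The identifications \<open>Y = W\<^sub>0\<close> and \<open>L(Z, W\<^sub>p) = W\<^sub>p\<^sub>+\<^sub>1\<close>.\<close>

definition mlin_const :: "'b \<Rightarrow> ('a::real_normed_vector, 'b::real_normed_vector) mlin" where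
  "mlin_const y = Mlin (\<lambda>vs. if vs = [] then y else 0)"

definition mlin_uncurry ::
  "('a \<Rightarrow> ('a, 'b) mlin) \<Rightarrow> ('a::real_normed_vector, 'b::real_normed_vector) mlin" where
  "mlin_uncurry B = Mlin (\<lambda>vs. case vs of [] \<Rightarrow> 0 | h # ws \<Rightarrow> mlin_apply (B h) ws)"

text \<open>
  A function on the open set \<open>\<Omega>\<close> is represented by a total function whose values off \<open>\<Omega>\<close> are
  irrelevant: at points of \<open>\<Omega>\<close> the differentials only depend on the function near that point.
\<close>

primrec differential :: "nat \<Rightarrow> ('a \<Rightarrow> 'b) \<Rightarrow>
    'a \<Rightarrow> ('a::real_normed_vector, 'b::real_normed_vector) mlin" where
  "differential 0 f = (\<lambda>x. mlin_const (f x))"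
| "differential (Suc p) f = (\<lambda>x. mlin_uncurry (frechet_derivative (differential p f) (at x)))"

definition C_space :: "nat \<Rightarrow> 'a set \<Rightarrow>
    ('a::real_normed_vector \<Rightarrow> 'b::real_normed_vector) set" where
  "C_space k \<Omega> = {f.
     (\<forall>p<k. \<forall>x\<in>\<Omega>. differential p f differentiable (at x)) \<and>
     (\<forall>p\<le>k. continuous_on \<Omega> (differential p f))}"

lemma mlin_apply_const: "mlin_apply (mlin_const y :: ('a::real_normed_vector, 'b::real_normed_vector) mlin) = (\<lambda>vs. if vs = [] then y else 0)"
  unfolding mlin_const_def
proof (rule Mlin_inverse'[where C = "norm y"])
  show "norm (if vs = [] then y else 0) \<le> norm y * prod_list (map norm vs)" for vs :: "'a list"
  proof -
    have "0 \<le> prod_list (map norm vs)" by (induction vs) auto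
    then show ?thesis by auto
  qed
qed (auto intro: linear_zero)

lemma mlin_apply_uncurry:
  assumes "bounded_linear B"
  shows "mlin_apply (mlin_uncurry B) = (\<lambda>vs. case vs of [] \<Rightarrow> 0 | h # ws \<Rightarrow> mlin_apply (B h) ws)"
  unfolding mlin_uncurry_def
proof (rule Mlin_inverse'[where C = "onorm B"])
  interpret B: bounded_linear B by fact
  show "linear (\<lambda>v. case xs @ v # ys of [] \<Rightarrow> 0 | h # ws \<Rightarrow> mlin_apply (B h) ws)" for xs ys
  proof (cases xs)
    case Nil
    then show ?thesis
      by (auto intro!: linearI simp: B.add B.scaleR mlin_apply_add mlin_apply_scaleR)
  qed (simp add: linear_mlin_apply)
  show "norm (case vs of [] \<Rightarrow> 0 | h # ws \<Rightarrow> mlin_apply (B h) ws)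
      \<le> onorm B * prod_list (map norm vs)" for vs
  proof (cases vs)
    case Nil
    then show ?thesis using onorm_pos_le[OF assms] by simp
  next
    case (Cons h ws)
    have "0 \<le> prod_list (map norm ws)" by (induction ws) auto
    then have "norm (mlin_apply (B h) ws) \<le> (onorm B * norm h) * prod_list (map norm ws)"
      by (intro order.trans[OF norm_mlin_apply] mult_right_mono onorm assms)
    then show ?thesis using Cons by (simp add: mult.assoc)
  qed
qed

lemma bounded_linear_mlin_apply: "bounded_linear (\<lambda>T. mlin_apply T vs)"
  by (rule bounded_linear_intro[where K = "prod_list (map norm vs)"])
     (auto simp: mlin_apply_add mlin_apply_scaleR norm_mlin_apply)

lemma differential_in_mlin_space:
  assumes "open \<Omega>" "f \<in> C_space k \<Omega>" "p \<le> k" "x \<in> \<Omega>"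
  shows "differential p f x \<in> mlin_space p"
  using assms(3,4)
proof (induction p arbitrary: x)
  case 0
  then show ?case by (auto simp: mlin_space_def mlin_apply_const)
next
  case (Suc p)
  define B where "B = frechet_derivative (differential p f) (at x)"
  have D: "(differential p f has_derivative B) (at x)"
    using assms(2) Suc.prems by (auto simp: B_def C_space_def frechet_derivative_works[symmetric])
  then have B: "bounded_linear B" by (rule has_derivative_bounded_linear)
  have "mlin_apply (B h) ws = 0" if "length ws \<noteq> p" for h ws
  proof -
    have "((\<lambda>x. mlin_apply (differential p f x) ws) has_derivative (\<lambda>h. mlin_apply (B h) ws)) (at x)"
      by (rule bounded_linear.has_derivative[OF bounded_linear_mlin_apply D])
    moreover have "((\<lambda>x. mlin_apply (differential p f x) ws) has_derivative (\<lambda>_. 0)) (at x)"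
    proof (rule has_derivative_transform_within_open[OF has_derivative_const assms(1)])
      show "0 = mlin_apply (differential p f y) ws" if "y \<in> \<Omega>" for y
        using Suc.IH[of y] Suc.prems that \<open>length ws \<noteq> p\<close> by (simp add: mlin_space_def)
    qed (use Suc.prems in auto)
    ultimately show ?thesis by (metis has_derivative_unique)
  qed
  then show ?case
    by (auto simp: mlin_space_def mlin_apply_uncurry[OF B] B_def[symmetric] split: list.split)
qed


section \<open>The locally convex space and the measures of noncompactness\<close>

text \<open>
  All quantities take values in \<open>[0, \<infinity>]\<close>, so that suprema over the empty set are \<open>0\<close>.
\<close>

definition C_seminorm :: "nat \<Rightarrow> 'a set \<Rightarrow>
    ('a::real_normed_vector \<Rightarrow> 'b::real_normed_vector) \<Rightarrow> ennreal" where
  "C_seminorm k K f = (MAX p\<in>{..k}. SUP x\<in>K. ennreal (norm (differential p f x)))"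

definition D_bounded :: "nat \<Rightarrow> 'a set \<Rightarrow>
    ('a::real_normed_vector \<Rightarrow> 'b::real_normed_vector) set \<Rightarrow> bool" where
  "D_bounded k \<Omega> M \<longleftrightarrow>
    (\<forall>K. compact K \<and> K \<subseteq> \<Omega> \<longrightarrow> (\<exists>C::real. \<forall>f\<in>M. C_seminorm k K f \<le> ennreal C))"

definition diam :: "('x \<Rightarrow> 'x \<Rightarrow> ennreal) \<Rightarrow> 'x set \<Rightarrow> ennreal" where
  "diam d A = (SUP x\<in>A. SUP y\<in>A. d x y)"

text \<open>Kuratowski measure of noncompactness in the space \<open>X\<close> with (pseudo)metric \<open>d\<close>.\<close>

definition kuratowski :: "'x set \<Rightarrow> ('x \<Rightarrow> 'x \<Rightarrow> ennreal) \<Rightarrow> 'x set \<Rightarrow> ennreal" where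
  "kuratowski X d M = Inf {ennreal \<epsilon> | \<epsilon>. \<epsilon> > 0 \<and>
     (\<exists>\<A>. finite \<A> \<and> M \<subseteq> \<Union>\<A> \<and> (\<forall>A\<in>\<A>. A \<subseteq> X \<and> diam d A \<le> ennreal \<epsilon>))}"

definition edist :: "'x::metric_space \<Rightarrow> 'x \<Rightarrow> ennreal" where
  "edist x y = ennreal (dist x y)"

definition alpha_D :: "nat \<Rightarrow> 'a set \<Rightarrow>
    ('a::real_normed_vector \<Rightarrow> 'b::real_normed_vector) set \<Rightarrow> 'a set \<Rightarrow> ennreal" where
  "alpha_D k \<Omega> M K = kuratowski (C_space k \<Omega>) (\<lambda>f g. C_seminorm k K (\<lambda>x. f x - g x)) M"

definition mu_alpha :: "nat \<Rightarrow>
    ('a::real_normed_vector \<Rightarrow> 'b::real_normed_vector) set \<Rightarrow> 'a set \<Rightarrow> ennreal" where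
  "mu_alpha k M K =
    (MAX p\<in>{..k}. SUP x\<in>K. kuratowski (mlin_space p) edist ((\<lambda>f. differential p f x) ` M))"

definition omega_D :: "nat \<Rightarrow>
    ('a::real_normed_vector \<Rightarrow> 'b::real_normed_vector) set \<Rightarrow> 'a set \<Rightarrow> ennreal" where
  "omega_D k M K =
    (MAX p\<in>{..k}. Inf {ennreal \<epsilon> | \<epsilon>. \<epsilon> > 0 \<and>
       (\<exists>P. finite P \<and> partition_on K P \<and>
          (\<forall>f\<in>M. \<forall>A\<in>P. diam edist (differential p f ` A) \<le> ennreal \<epsilon>))})"

end

theory Submission
  imports Defs
begin

text \<open>
  If two functions lie in the same cell of an \<open>\<epsilon>\<close>-cover of \<open>M\<close>, their differentials are
  \<open>\<epsilon>\<close>-close at every point of \<open>K\<close>; evaluation at a point thus bounds \<open>mu_alpha\<close>, and a partition of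
  \<open>K\<close> on which the differentials of one representative per cell are nearly constant bounds
  \<open>omega_D\<close>. Conversely, choose for every order a partition of \<open>K\<close> into sets on which all the
  differentials oscillate by at most \<open>w\<close>, and one point in each set: a common refinement of
  \<open>m\<close>-covers of the values at these finitely many points is an \<open>(m + 2w)\<close>-cover of \<open>M\<close>.
\<close>

section \<open>Common refinements and oscillation on compact sets\<close>

text \<open>Every point picks one cell of each cover; points with the same picks form a class. It is
  used twice: on \<open>K\<close> to serve all representatives at once, and on \<open>M\<close> to
  combine covers belonging to different orders and points.\<close>

lemma finite_partition_refining_covers:
  assumes I: "finite I" and fin: "\<And>i. i \<in> I \<Longrightarrow> finite (\<A> i)"
    and cov: "\<And>i. i \<in> I \<Longrightarrow> S \<subseteq> \<Union>(\<A> i)"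
  obtains P where "finite P" "partition_on S P" "\<And>B i. B \<in> P \<Longrightarrow> i \<in> I \<Longrightarrow> \<exists>A\<in>\<A> i. B \<subseteq> A"
proof -
  \<comment> \<open>Restricting the choice function to \<open>I\<close> makes it an element of
    \<open>PiE I \<A>\<close>, which is finite.\<close>
  define c where "c x = (\<lambda>i\<in>I. SOME A. A \<in> \<A> i \<and> x \<in> A)" for x
  have c: "c x i \<in> \<A> i \<and> x \<in> c x i" if "x \<in> S" "i \<in> I" for x i
    using someI_ex[of "\<lambda>A. A \<in> \<A> i \<and> x \<in> A"] cov[of i] that by (auto simp: c_def)
  \<comment> \<open>Only choices that actually occur are indexed, so no class is empty, as
    \<open>partition_on\<close> demands.\<close>
  define P where "P = (\<lambda>s. {x\<in>S. c x = s}) ` c ` S"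
  have "c ` S \<subseteq> PiE I \<A>"
    using c by (auto simp: c_def PiE_def)
  then have "finite (c ` S)"
    by (rule finite_subset) (intro finite_PiE I fin)
  then have "finite P" by (simp add: P_def)
  moreover have "partition_on S P"
    by (auto simp: P_def intro!: partition_onI simp: disjnt_def)
  moreover have "\<exists>A\<in>\<A> i. B \<subseteq> A" if B: "B \<in> P" and i: "i \<in> I" for B i
  proof -
    obtain x where x: "x \<in> S" and B_eq: "B = {y\<in>S. c y = c x}"
      using B by (auto simp: P_def)
    have "B \<subseteq> c x i" unfolding B_eq using c[OF _ i] by force
    then show ?thesis using c[OF x i] by blast
  qed
  ultimately show thesis by (rule that)
qed

text \<open>The image of \<open>K\<close> is compact, hence totally bounded; preimages of finitely
  many balls of radius \<open>e/2\<close> do the job.\<close>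

lemma compact_cover_small_oscillation:
  fixes f :: "'a::topological_space \<Rightarrow> 'b::metric_space"
  assumes "compact K" "continuous_on K f" "e > 0"
  obtains \<A> where "finite \<A>" "K \<subseteq> \<Union>\<A>" "\<And>A x y. A \<in> \<A> \<Longrightarrow> x \<in> A \<Longrightarrow> y \<in> A \<Longrightarrow> dist (f x) (f y) \<le> e"
proof -
  have "compact (f ` K)" using assms(2,1) by (rule compact_continuous_image)
  then obtain F where F: "finite F" "f ` K \<subseteq> (\<Union>c\<in>F. ball c (e/2))"
    using \<open>e > 0\<close> compact_imp_seq_compact seq_compact_imp_totally_bounded
    by (metis half_gt_zero)
  show thesis
  proof (rule that[of "(\<lambda>c. f -` ball c (e/2)) ` F"])
    show "finite ((\<lambda>c. f -` ball c (e/2)) ` F)" using F by simp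
    show "K \<subseteq> \<Union>((\<lambda>c. f -` ball c (e/2)) ` F)" using F(2) by blast
    fix A x y assume "A \<in> (\<lambda>c. f -` ball c (e/2)) ` F" "x \<in> A" "y \<in> A"
    then show "dist (f x) (f y) \<le> e"
    proof clarsimp
      fix c assume "dist c (f x) * 2 < e" "dist c (f y) * 2 < e"
      then show ?thesis using dist_triangle3[of "f x" "f y" c] by linarith
    qed
  qed
qed

section \<open>The defining infima rephrased through distances\<close>

lemma diam_le_iff: "diam d A \<le> c \<longleftrightarrow> (\<forall>x\<in>A. \<forall>y\<in>A. d x y \<le> c)"
  by (auto simp: diam_def SUP_le_iff)

lemma kuratowski_le:
  assumes "\<epsilon> > 0" "finite \<A>" "M \<subseteq> \<Union>\<A>"
    and "\<And>A. A \<in> \<A> \<Longrightarrow> A \<subseteq> X" "\<And>A x y. A \<in> \<A> \<Longrightarrow> x \<in> A \<Longrightarrow> y \<in> A \<Longrightarrow> d x y \<le> ennreal \<epsilon>"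
  shows "kuratowski X d M \<le> ennreal \<epsilon>"
  unfolding kuratowski_def
  by (rule Inf_lower) (use assms in \<open>auto simp: diam_le_iff intro!: exI[of _ \<epsilon>] exI[of _ \<A>]\<close>)

text \<open>The infimum need not be attained, but some admissible \<open>\<epsilon>\<close> lies
  below any strict upper bound, and its cover serves for that bound too.\<close>

lemma kuratowski_less_obtains:
  assumes "kuratowski X d M < ennreal c"
  obtains \<A> where "finite \<A>" "M \<subseteq> \<Union>\<A>" "\<And>A. A \<in> \<A> \<Longrightarrow> A \<subseteq> X"
    "\<And>A x y. A \<in> \<A> \<Longrightarrow> x \<in> A \<Longrightarrow> y \<in> A \<Longrightarrow> d x y \<le> ennreal c"
proof -
  obtain \<epsilon> \<A> where *: "ennreal \<epsilon> < ennreal c" "finite \<A>" "M \<subseteq> \<Union>\<A>"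
    "\<forall>A\<in>\<A>. A \<subseteq> X \<and> diam d A \<le> ennreal \<epsilon>"
    using assms unfolding kuratowski_def Inf_less_iff Bex_def mem_Collect_eq
    by (elim exE conjE, hypsubst) (rule that; assumption)
  have "d x y \<le> ennreal c" if "A \<in> \<A>" "x \<in> A" "y \<in> A" for A x y
  proof -
    have "d x y \<le> ennreal \<epsilon>" using *(4) that by (auto simp: diam_le_iff)
    then show ?thesis using *(1) by (rule order.trans[OF _ less_imp_le])
  qed
  with * show thesis by (intro that[of \<A>]) blast+
qed

lemma mu_alpha_le_iff:
  "mu_alpha k M K \<le> c \<longleftrightarrow>
    (\<forall>p\<le>k. \<forall>x\<in>K. kuratowski (mlin_space p) edist ((\<lambda>f. differential p f x) ` M) \<le> c)"
  by (auto simp: mu_alpha_def SUP_le_iff)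

lemma omega_D_le:
  assumes "\<epsilon> > 0"
    and "\<And>p. p \<le> k \<Longrightarrow> \<exists>P. finite P \<and> partition_on K P \<and>
      (\<forall>f\<in>M. \<forall>A\<in>P. \<forall>x\<in>A. \<forall>y\<in>A. dist (differential p f x) (differential p f y) \<le> \<epsilon>)"
  shows "omega_D k M K \<le> ennreal \<epsilon>"
proof -
  have "Inf {ennreal \<epsilon> | \<epsilon>. \<epsilon> > 0 \<and> (\<exists>P. finite P \<and> partition_on K P \<and>
      (\<forall>f\<in>M. \<forall>A\<in>P. diam edist (differential p f ` A) \<le> ennreal \<epsilon>))} \<le> ennreal \<epsilon>"
    if "p \<le> k" for p
    by (rule Inf_lower) (use assms(1) assms(2)[OF that] in \<open>force simp: diam_le_iff edist_def\<close>)
  then show ?thesis unfolding omega_D_def by auto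
qed

lemma omega_D_less_obtains:
  assumes "omega_D k M K < ennreal c" "p \<le> k"
  obtains P where "finite P" "partition_on K P"
    "\<And>f A x y. f \<in> M \<Longrightarrow> A \<in> P \<Longrightarrow> x \<in> A \<Longrightarrow> y \<in> A \<Longrightarrow>
      dist (differential p f x) (differential p f y) \<le> c"
proof -
  have "Inf {ennreal \<epsilon> | \<epsilon>. \<epsilon> > 0 \<and> (\<exists>P. finite P \<and> partition_on K P \<and>
      (\<forall>f\<in>M. \<forall>A\<in>P. diam edist (differential p f ` A) \<le> ennreal \<epsilon>))} < ennreal c"
    using assms by (auto simp: omega_D_def)
  then obtain \<epsilon> P where *: "\<epsilon> > 0" "ennreal \<epsilon> < ennreal c" "finite P" "partition_on K P"
    "\<forall>f\<in>M. \<forall>A\<in>P. diam edist (differential p f ` A) \<le> ennreal \<epsilon>"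
    unfolding Inf_less_iff by blast
  then have "\<epsilon> < c" by (simp add: ennreal_less_iff)
  with * show thesis
    by (intro that[of P]) (force simp: diam_le_iff edist_def)+
qed

section \<open>The seminorms and \<open>alpha_D\<close> in terms of differentials\<close>

text \<open>The sign condition matters because \<open>ennreal\<close> maps negative reals to 0,
  where the left side could hold and the right side fail.\<close>

lemma C_seminorm_le_iff:
  assumes "c \<ge> 0"
  shows "C_seminorm k K f \<le> ennreal c \<longleftrightarrow> (\<forall>p\<le>k. \<forall>x\<in>K. norm (differential p f x) \<le> c)"
  using assms by (auto simp: C_seminorm_def SUP_le_iff)

lemma mlin_uncurry_diff:
  assumes "bounded_linear F" "bounded_linear G"
  shows "mlin_uncurry (\<lambda>h. F h - G h) = mlin_uncurry F - mlin_uncurry G"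
  by (rule mlin_eqI)
    (simp add: mlin_apply_uncurry assms bounded_linear_sub mlin_apply_diff split: list.split)

text \<open>Induction on the order: differentiation is additive, and so is the identification of
  \<open>L(Z, W_p)\<close> with \<open>W_(p+1)\<close> by \<open>mlin_uncurry\<close>.\<close>

lemma differential_diff:
  assumes "open \<Omega>" "f \<in> C_space k \<Omega>" "g \<in> C_space k \<Omega>" "p \<le> k" "x \<in> \<Omega>"
  shows "differential p (\<lambda>x. f x - g x) x = differential p f x - differential p g x"
  using assms(4,5)
proof (induction p arbitrary: x)
  case 0
  then show ?case by (auto intro!: mlin_eqI simp: mlin_apply_const mlin_apply_diff)
next
  case (Suc p)
  define F where "F = frechet_derivative (differential p f) (at x)"
  define G where "G = frechet_derivative (differential p g) (at x)"
  have F: "(differential p f has_derivative F) (at x)"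
    and G: "(differential p g has_derivative G) (at x)"
    using assms(2,3) Suc.prems
    by (auto simp: F_def G_def C_space_def frechet_derivative_works[symmetric])
  \<comment> \<open>The induction hypothesis gives equality only on \<open>\<Omega>\<close>; since
    \<open>\<Omega>\<close> is open, this determines the derivative at \<open>x\<close>.\<close>
  have "(differential p (\<lambda>x. f x - g x) has_derivative (\<lambda>h. F h - G h)) (at x)"
    by (rule has_derivative_transform_within_open[OF has_derivative_diff[OF F G] assms(1)])
      (use Suc in auto)
  then have "frechet_derivative (differential p (\<lambda>x. f x - g x)) (at x) = (\<lambda>h. F h - G h)"
    by (rule frechet_derivative_at[symmetric])
  then show ?case
    using mlin_uncurry_diff[OF F[THEN has_derivative_bounded_linear]
        G[THEN has_derivative_bounded_linear]]
    by (simp add: F_def G_def)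
qed

lemma C_seminorm_diff_le_iff:
  assumes "open \<Omega>" "K \<subseteq> \<Omega>" "f \<in> C_space k \<Omega>" "g \<in> C_space k \<Omega>" "c \<ge> 0"
  shows "C_seminorm k K (\<lambda>x. f x - g x) \<le> ennreal c \<longleftrightarrow>
    (\<forall>p\<le>k. \<forall>x\<in>K. dist (differential p f x) (differential p g x) \<le> c)"
  using assms by (auto simp: C_seminorm_le_iff dist_norm differential_diff[OF assms(1,3,4)] subset_iff)

lemma alpha_D_less_obtains:
  assumes "open \<Omega>" "K \<subseteq> \<Omega>" "alpha_D k \<Omega> M K < ennreal c"
  obtains \<A> where "finite \<A>" "M \<subseteq> \<Union>\<A>" "\<And>A. A \<in> \<A> \<Longrightarrow> A \<subseteq> C_space k \<Omega>"
    "\<And>A f g p x. A \<in> \<A> \<Longrightarrow> f \<in> A \<Longrightarrow> g \<in> A \<Longrightarrow> p \<le> k \<Longrightarrow> x \<in> K \<Longrightarrow>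
      dist (differential p f x) (differential p g x) \<le> c"
proof -
  \<comment> \<open>A negative \<open>c\<close> would give \<open>ennreal c = 0\<close>, and nothing
    lies strictly below 0.\<close>
  have "c \<ge> 0" using assms(3) by (metis ennreal_neg linorder_le_cases not_less_zero)
  obtain \<A> where *: "finite \<A>" "M \<subseteq> \<Union>\<A>" "\<And>A. A \<in> \<A> \<Longrightarrow> A \<subseteq> C_space k \<Omega>"
    and d: "\<And>A f g. A \<in> \<A> \<Longrightarrow> f \<in> A \<Longrightarrow> g \<in> A \<Longrightarrow> C_seminorm k K (\<lambda>x. f x - g x) \<le> ennreal c"
    by (rule kuratowski_less_obtains[OF assms(3)[unfolded alpha_D_def]]) (rule that)
  have "dist (differential p f x) (differential p g x) \<le> c"
    if "A \<in> \<A>" "f \<in> A" "g \<in> A" "p \<le> k" "x \<in> K" for A f g p x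
    using d[of A f g] that *(3) C_seminorm_diff_le_iff[OF assms(1,2) _ _ \<open>c \<ge> 0\<close>] by blast
  with * show thesis by (rule that)
qed

lemma alpha_D_le:
  assumes "open \<Omega>" "K \<subseteq> \<Omega>" "\<epsilon> > 0" "finite \<A>" "M \<subseteq> \<Union>\<A>" "\<And>A. A \<in> \<A> \<Longrightarrow> A \<subseteq> C_space k \<Omega>"
    and "\<And>A f g p x. A \<in> \<A> \<Longrightarrow> f \<in> A \<Longrightarrow> g \<in> A \<Longrightarrow> p \<le> k \<Longrightarrow> x \<in> K \<Longrightarrow>
      dist (differential p f x) (differential p g x) \<le> \<epsilon>"
  shows "alpha_D k \<Omega> M K \<le> ennreal \<epsilon>"
  unfolding alpha_D_def
proof (rule kuratowski_le[OF assms(3-6)])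
  fix A f g assume A: "A \<in> \<A>" "f \<in> A" "g \<in> A"
  then have "f \<in> C_space k \<Omega>" "g \<in> C_space k \<Omega>" using assms(6) by auto
  then show "C_seminorm k K (\<lambda>x. f x - g x) \<le> ennreal \<epsilon>"
    using assms(3) by (simp add: C_seminorm_diff_le_iff[OF assms(1,2)] assms(7)[OF A])
qed

text \<open>\<open>M\<close> alone is a cover of itself, of diameter at most twice a bound for the
  seminorm on \<open>M\<close>.\<close>

lemma alpha_D_finite:
  assumes "open \<Omega>" "compact K" "K \<subseteq> \<Omega>" "M \<subseteq> C_space k \<Omega>" "D_bounded k \<Omega> M"
  shows "alpha_D k \<Omega> M K < \<infinity>"
proof -
  have "\<exists>C::real. \<forall>f\<in>M. C_seminorm k K f \<le> ennreal C"
    using assms(2,3,5) by (simp add: D_bounded_def)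
  then obtain C :: real where C: "\<And>f. f \<in> M \<Longrightarrow> C_seminorm k K f \<le> ennreal C"
    by auto
  \<comment> \<open>The bound \<open>C\<close> may be 0 or negative, whereas admissible radii are
    positive.\<close>
  define c where "c = max 1 C"
  have "C_seminorm k K f \<le> ennreal c" if "f \<in> M" for f
    using C[OF that] by (rule order.trans) (simp add: c_def ennreal_leI)
  then have c: "norm (differential p f x) \<le> c" if "f \<in> M" "p \<le> k" "x \<in> K" for f p x
    using that C_seminorm_le_iff[of c k K f] by (auto simp: c_def)
  have "alpha_D k \<Omega> M K \<le> ennreal (2 * c)"
  proof (rule alpha_D_le[OF assms(1,3), where \<A> = "{M}"])
    show "dist (differential p f x) (differential p g x) \<le> 2 * c"
      if "A \<in> {M}" "f \<in> A" "g \<in> A" "p \<le> k" "x \<in> K" for A f g p x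
      using c[of f p x] c[of g p x] that norm_triangle_ineq4[of "differential p f x" "differential p g x"]
      by (auto simp: dist_norm)
  qed (use assms in \<open>auto simp: c_def\<close>)
  then show ?thesis by (rule order.strict_trans1) simp
qed

section \<open>The three inequalities\<close>

text \<open>For fixed \<open>p\<close> and \<open>x\<close> in \<open>K\<close>, passing from
  \<open>f\<close> to \<open>differential p f x\<close> does not increase distances, so the images
  of the cells of a cover of \<open>M\<close> form an equally fine cover in
  \<open>mlin_space p\<close>.\<close>

lemma mu_alpha_le_alpha_D:
  assumes "open \<Omega>" "K \<subseteq> \<Omega>"
  shows "mu_alpha k M K \<le> alpha_D k \<Omega> M K"
\<comment> \<open>This rule allows the right side to be taken finite, hence a real number, and
  leaves a slack \<open>e\<close> that makes the bound on the infimum strict.\<close>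
proof (rule ennreal_le_epsilon)
  fix e :: real assume e: "e > 0" and fin: "alpha_D k \<Omega> M K < top"
  obtain a where a: "alpha_D k \<Omega> M K = ennreal a" "a \<ge> 0"
    using fin by (cases "alpha_D k \<Omega> M K") auto
  have "alpha_D k \<Omega> M K < ennreal (a + e)" using a e by (simp add: ennreal_less_iff)
  then obtain \<A> where A: "finite \<A>" "M \<subseteq> \<Union>\<A>" "\<And>A. A \<in> \<A> \<Longrightarrow> A \<subseteq> C_space k \<Omega>"
    and d: "\<And>A f g p x. A \<in> \<A> \<Longrightarrow> f \<in> A \<Longrightarrow> g \<in> A \<Longrightarrow> p \<le> k \<Longrightarrow> x \<in> K \<Longrightarrow>
      dist (differential p f x) (differential p g x) \<le> a + e"
    by (rule alpha_D_less_obtains[OF assms]) (rule that)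
  have "kuratowski (mlin_space p) edist ((\<lambda>f. differential p f x) ` M) \<le> ennreal (a + e)"
    if "p \<le> k" "x \<in> K" for p x
  proof (rule kuratowski_le[where \<A> = "(\<lambda>A. (\<lambda>f. differential p f x) ` A) ` \<A>"])
    show "(\<lambda>f. differential p f x) ` M \<subseteq> \<Union>((\<lambda>A. (\<lambda>f. differential p f x) ` A) ` \<A>)"
      using A(2) by blast
    show "B \<subseteq> mlin_space p" if "B \<in> (\<lambda>A. (\<lambda>f. differential p f x) ` A) ` \<A>" for B
      using that A(3) differential_in_mlin_space[OF assms(1) _ \<open>p \<le> k\<close>] \<open>x \<in> K\<close> assms(2) by blast
  qed (use a e A(1) d that in \<open>auto simp: edist_def simp del: ennreal_plus intro!: ennreal_leI\<close>)
  then have "mu_alpha k M K \<le> ennreal (a + e)" by (simp add: mu_alpha_le_iff)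
  then show "mu_alpha k M K \<le> alpha_D k \<Omega> M K + ennreal e" using a e by simp
qed

text \<open>The factor 2 comes from replacing \<open>f\<close> by the representative of its cell at
  both \<open>x\<close> and \<open>y\<close>; between these points the representative itself hardly
  varies, by continuity on the compact set \<open>K\<close>.\<close>

lemma omega_D_le_alpha_D:
  assumes "open \<Omega>" "compact K" "K \<subseteq> \<Omega>"
  shows "omega_D k M K \<le> 2 * alpha_D k \<Omega> M K"
proof (rule ennreal_le_epsilon)
  fix e :: real assume e: "e > 0" and fin: "2 * alpha_D k \<Omega> M K < top"
  have "alpha_D k \<Omega> M K < top" using fin by (auto simp: ennreal_mult_less_top)
  then obtain a where a: "alpha_D k \<Omega> M K = ennreal a" "a \<ge> 0"
    by (cases "alpha_D k \<Omega> M K") auto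
  \<comment> \<open>Two errors \<open>e/4\<close> and one oscillation \<open>e/2\<close> add up to
    \<open>e\<close>.\<close>
  have "alpha_D k \<Omega> M K < ennreal (a + e/4)" using a e by (simp add: ennreal_less_iff)
  then obtain \<A> where A: "finite \<A>" "M \<subseteq> \<Union>\<A>" "\<And>A. A \<in> \<A> \<Longrightarrow> A \<subseteq> C_space k \<Omega>"
    and d: "\<And>A f g p x. A \<in> \<A> \<Longrightarrow> f \<in> A \<Longrightarrow> g \<in> A \<Longrightarrow> p \<le> k \<Longrightarrow> x \<in> K \<Longrightarrow>
      dist (differential p f x) (differential p g x) \<le> a + e/4"
    by (rule alpha_D_less_obtains[OF assms(1,3)]) (rule that)
  define r where "r A = (SOME f. f \<in> A)" for A :: "('a \<Rightarrow> 'b) set"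
  have r: "r A \<in> A" if "f \<in> A" for A f using that by (auto simp: r_def some_in_eq)
  \<comment> \<open>An empty cell has no representative, so \<open>r\<close> would be an arbitrary
    function there.\<close>
  define \<A>' where "\<A>' = \<A> - {{}}"
  have "omega_D k M K \<le> ennreal (2 * a + e)"
  proof (rule omega_D_le)
    fix p assume p: "p \<le> k"
    have "\<exists>\<B>. finite \<B> \<and> K \<subseteq> \<Union>\<B> \<and>
        (\<forall>B\<in>\<B>. \<forall>x\<in>B. \<forall>y\<in>B. dist (differential p (r A) x) (differential p (r A) y) \<le> e/2)"
      if "A \<in> \<A>'" for A
    proof -
      have "r A \<in> C_space k \<Omega>" using that r A(3) by (auto simp: \<A>'_def)
      then have "continuous_on K (differential p (r A))"
        using p assms(3) by (auto simp: C_space_def intro: continuous_on_subset)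
      from compact_cover_small_oscillation[OF assms(2) this, of "e/2"] e
      show ?thesis by (metis half_gt_zero)
    qed
    then obtain \<B> where B: "\<And>A. A \<in> \<A>' \<Longrightarrow> finite (\<B> A)" "\<And>A. A \<in> \<A>' \<Longrightarrow> K \<subseteq> \<Union>(\<B> A)"
      and osc: "\<And>A B x y. A \<in> \<A>' \<Longrightarrow> B \<in> \<B> A \<Longrightarrow> x \<in> B \<Longrightarrow> y \<in> B \<Longrightarrow>
        dist (differential p (r A) x) (differential p (r A) y) \<le> e/2"
      by metis
    \<comment> \<open>There are finitely many representatives, so one partition suits them all, and
      through them every \<open>f\<close> in \<open>M\<close>.\<close>
    obtain P where P: "finite P" "partition_on K P"
      "\<And>Q A. Q \<in> P \<Longrightarrow> A \<in> \<A>' \<Longrightarrow> \<exists>B\<in>\<B> A. Q \<subseteq> B"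
      using finite_partition_refining_covers[of \<A>' \<B> K] A(1) B by (auto simp: \<A>'_def)
    have "dist (differential p f x) (differential p f y) \<le> 2 * a + e"
      if f: "f \<in> M" and Q: "Q \<in> P" and x: "x \<in> Q" and y: "y \<in> Q" for f Q x y
    proof -
      obtain A where A': "A \<in> \<A>" "f \<in> A" using f A(2) by blast
      then have "A \<in> \<A>'" by (auto simp: \<A>'_def)
      with P(3)[OF Q] obtain B where "B \<in> \<B> A" "Q \<subseteq> B" by blast
      then have 1: "dist (differential p (r A) x) (differential p (r A) y) \<le> e/2"
        using osc[OF \<open>A \<in> \<A>'\<close>] x y by blast
      have "x \<in> K" "y \<in> K" using P(2) Q x y by (auto simp: partition_on_def)
      then have "dist (differential p f x) (differential p (r A) x) \<le> a + e/4"
        "dist (differential p f y) (differential p (r A) y) \<le> a + e/4"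
        using d[OF A'(1,2) r[OF A'(2)] p] by auto
      with 1 show ?thesis by metric
    qed
    with P show "\<exists>P. finite P \<and> partition_on K P \<and>
        (\<forall>f\<in>M. \<forall>Q\<in>P. \<forall>x\<in>Q. \<forall>y\<in>Q. dist (differential p f x) (differential p f y) \<le> 2 * a + e)"
      by blast
  qed (use a e in auto)
  also have "\<dots> = 2 * alpha_D k \<Omega> M K + ennreal e"
    using a e by (simp add: ennreal_mult)
  finally show "omega_D k M K \<le> 2 * alpha_D k \<Omega> M K + ennreal e" .
qed

text \<open>Moving from \<open>x\<close> to the sample point of its class costs one oscillation for
  \<open>f\<close> and one for \<open>g\<close>, whence the coefficient 2; at the sample point the
  covers from \<open>mu_alpha\<close> control the distance.\<close>

lemma alpha_D_le_mu_omega: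
  assumes "open \<Omega>" "K \<subseteq> \<Omega>" "M \<subseteq> C_space k \<Omega>"
  shows "alpha_D k \<Omega> M K \<le> mu_alpha k M K + 2 * omega_D k M K"
proof (rule ennreal_le_epsilon)
  fix e :: real assume e: "e > 0" and fin: "mu_alpha k M K + 2 * omega_D k M K < top"
  have "mu_alpha k M K < top" "omega_D k M K < top" using fin by (auto simp: ennreal_mult_less_top)
  then obtain m w where m: "mu_alpha k M K = ennreal m" "m \<ge> 0"
    and w: "omega_D k M K = ennreal w" "w \<ge> 0"
    by (cases "mu_alpha k M K"; cases "omega_D k M K") auto
  have "omega_D k M K < ennreal (w + e/3)" using w e by (simp add: ennreal_less_iff)
  then have "\<forall>p\<in>{..k}. \<exists>P. finite P \<and> partition_on K P \<and> (\<forall>f\<in>M. \<forall>Q\<in>P. \<forall>x\<in>Q. \<forall>y\<in>Q.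
      dist (differential p f x) (differential p f y) \<le> w + e/3)"
    by (metis omega_D_less_obtains atMost_iff)
  then obtain P where P: "\<And>p. p \<le> k \<Longrightarrow> finite (P p)" "\<And>p. p \<le> k \<Longrightarrow> partition_on K (P p)"
    and osc: "\<And>p f Q x y. p \<le> k \<Longrightarrow> f \<in> M \<Longrightarrow> Q \<in> P p \<Longrightarrow> x \<in> Q \<Longrightarrow> y \<in> Q \<Longrightarrow>
      dist (differential p f x) (differential p f y) \<le> w + e/3"
    by (metis atMost_iff)
  \<comment> \<open>The partition depends on the order, so a sampling condition is indexed by an
    order together with a class of its partition.\<close>
  define I where "I = (SIGMA p:{..k}. P p)"
  define z where "z Q = (SOME x. x \<in> Q)" for Q :: "'a set"
  have z: "z Q \<in> Q" if "x \<in> Q" for Q x using that by (auto simp: z_def some_in_eq)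
  have zK: "z Q \<in> K" if "p \<le> k" "Q \<in> P p" for p Q
  proof -
    have "Q \<noteq> {}" "Q \<subseteq> K" using P(2)[OF that(1)] that(2) by (auto simp: partition_on_def)
    then show ?thesis using z by blast
  qed
  have "\<exists>\<B>. finite \<B> \<and> M \<subseteq> \<Union>\<B> \<and> (\<forall>B\<in>\<B>. \<forall>f\<in>B. \<forall>g\<in>B.
      dist (differential (fst i) f (z (snd i))) (differential (fst i) g (z (snd i))) \<le> m + e/3)"
    if "i \<in> I" for i
  proof -
    from that obtain p Q where i: "i = (p, Q)" "p \<le> k" "Q \<in> P p" by (auto simp: I_def)
    let ?D = "\<lambda>f. differential p f (z Q)"
    have "kuratowski (mlin_space p) edist (?D ` M) \<le> ennreal m"
      using m mu_alpha_le_iff[of k M K "ennreal m"] i zK by auto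
    also have "\<dots> < ennreal (m + e/3)" using m e by (simp add: ennreal_less_iff)
    finally obtain \<C> where "finite \<C>" "?D ` M \<subseteq> \<Union>\<C>"
      "\<And>C S T. C \<in> \<C> \<Longrightarrow> S \<in> C \<Longrightarrow> T \<in> C \<Longrightarrow> edist S T \<le> ennreal (m + e/3)"
      by (rule kuratowski_less_obtains) (rule that)
    \<comment> \<open>The cover of the sampled values is pulled back to a cover of \<open>M\<close>
      by functions agreeing up to \<open>m + e/3\<close> at the sample point.\<close>
    then show ?thesis using m e
      by (intro exI[of _ "(\<lambda>C. ?D -` C) ` \<C>"]) (auto simp: i(1) edist_def image_subset_iff simp del: ennreal_plus)
  qed
  then obtain \<B> where B: "\<And>i. i \<in> I \<Longrightarrow> finite (\<B> i)" "\<And>i. i \<in> I \<Longrightarrow> M \<subseteq> \<Union>(\<B> i)"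
    and cl: "\<And>i B f g. i \<in> I \<Longrightarrow> B \<in> \<B> i \<Longrightarrow> f \<in> B \<Longrightarrow> g \<in> B \<Longrightarrow>
      dist (differential (fst i) f (z (snd i))) (differential (fst i) g (z (snd i))) \<le> m + e/3"
    by metis
  have "finite I" using P(1) by (auto simp: I_def)
  then obtain \<A> where A: "finite \<A>" "partition_on M \<A>" "\<And>A i. A \<in> \<A> \<Longrightarrow> i \<in> I \<Longrightarrow> \<exists>B\<in>\<B> i. A \<subseteq> B"
    using finite_partition_refining_covers[of I \<B> M] B by metis
  \<comment> \<open>The pulled-back sets may contain functions outside
    \<open>C_space k \<Omega>\<close>; the classes of the refinement lie in \<open>M\<close> and so
    avoid this.\<close>
  have sub: "A \<subseteq> M" if "A \<in> \<A>" for A using A(2) that by (auto simp: partition_on_def)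
  have "alpha_D k \<Omega> M K \<le> ennreal (m + 2 * w + e)"
  proof (rule alpha_D_le[OF assms(1,2) _ A(1)])
    fix A f g p x assume A': "A \<in> \<A>" "f \<in> A" "g \<in> A" and p: "p \<le> k" and x: "x \<in> K"
    obtain Q where Q: "Q \<in> P p" "x \<in> Q" using P(2)[OF p] x by (auto simp: partition_on_def)
    have i: "(p, Q) \<in> I" using p Q by (auto simp: I_def)
    obtain B where "B \<in> \<B> (p, Q)" "A \<subseteq> B" using A(3)[OF A'(1) i] by blast
    then have "dist (differential p f (z Q)) (differential p g (z Q)) \<le> m + e/3"
      using cl[OF i, of B f g] A' by auto
    moreover have "dist (differential p f x) (differential p f (z Q)) \<le> w + e/3"
      "dist (differential p g x) (differential p g (z Q)) \<le> w + e/3"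
      using osc[OF p _ Q(1,2) z[OF Q(2)]] sub A' by auto
    ultimately show "dist (differential p f x) (differential p g x) \<le> m + 2 * w + e" by metric
  qed (use m w e A sub assms(3) in \<open>auto simp: partition_on_def\<close>)
  also have "\<dots> = mu_alpha k M K + 2 * omega_D k M K + ennreal e"
    using m w e by (simp add: ennreal_mult)
  finally show "alpha_D k \<Omega> M K \<le> mu_alpha k M K + 2 * omega_D k M K + ennreal e" .
qed

theorem theorem4p5:
  fixes \<Omega> :: "'z::banach set" and M :: "('z \<Rightarrow> 'y::banach) set" and k :: nat
  assumes "open \<Omega>" and "\<Omega> \<noteq> {}"
    and "M \<noteq> {}" and "M \<subseteq> C_space k \<Omega>" and "D_bounded k \<Omega> M"
  shows "\<forall>K. compact K \<and> K \<subseteq> \<Omega> \<longrightarrow>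
    mu_alpha k M K < \<infinity> \<and> omega_D k M K < \<infinity> \<and> alpha_D k \<Omega> M K < \<infinity> \<and>
    max (mu_alpha k M K) (omega_D k M K / 2) \<le> alpha_D k \<Omega> M K \<and>
    alpha_D k \<Omega> M K \<le> mu_alpha k M K + 2 * omega_D k M K"
proof (intro allI impI, elim conjE)
  fix K assume K: "compact K" "K \<subseteq> \<Omega>"
  \<comment> \<open>Boundedness of \<open>M\<close> enters here; the other two measures are then
    finite because they are dominated by multiples of \<open>alpha_D\<close>.\<close>
  have fin: "alpha_D k \<Omega> M K < \<infinity>" by (rule alpha_D_finite[OF assms(1) K assms(4,5)])
  have mu: "mu_alpha k M K \<le> alpha_D k \<Omega> M K" by (rule mu_alpha_le_alpha_D[OF assms(1) K(2)])
  have om: "omega_D k M K \<le> 2 * alpha_D k \<Omega> M K" by (rule omega_D_le_alpha_D[OF assms(1) K])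
  have "omega_D k M K / 2 \<le> 2 * alpha_D k \<Omega> M K / 2" by (rule divide_right_mono_ennreal[OF om])
  also have "\<dots> = alpha_D k \<Omega> M K" by (subst mult.commute) (simp add: ennreal_mult_divide_eq)
  finally have "omega_D k M K / 2 \<le> alpha_D k \<Omega> M K" .
  moreover have "omega_D k M K < \<infinity>"
    using om by (rule order.strict_trans1) (use fin in \<open>simp add: ennreal_mult_less_top\<close>)
  moreover have "mu_alpha k M K < \<infinity>" using mu fin by (rule order.strict_trans1)
  ultimately show "mu_alpha k M K < \<infinity> \<and> omega_D k M K < \<infinity> \<and> alpha_D k \<Omega> M K < \<infinity> \<and>
      max (mu_alpha k M K) (omega_D k M K / 2) \<le> alpha_D k \<Omega> M K \<and>
      alpha_D k \<Omega> M K \<le> mu_alpha k M K + 2 * omega_D k M K"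
    using fin mu alpha_D_le_mu_omega[OF assms(1) K(2) assms(4)] by simp
qed

end
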